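(* Every punctual equivalence relation $R_Z$ (with $Z\subseteq\omega$) such that $R_Z<_{pr}\mathrm{Id}$ is meet-reducible in $\mathbf{Peq}$; that is, there are punctual equivalence relations $S_0,S_1$ with $R_Z<_{pr}S_0$ and $R_Z<_{pr}S_1$ such that the degree of $R_Z$ is the meet in $\mathbf{Peq}$ of the degrees of $S_0$ and $S_1$.
   Context: A punctual equivalence relation is a primitive recursive equivalence relation with domain $\omega$ having infinitely many equivalence classes. $\mathrm{Id}$ is equality on $\omega$. For equivalence relations $R,S$ on $\omega$, $R\leq_{pr} S$ means that there is a primitive recursive function $f:\omega\to\omega$ such that for all $x,y\in\omega$, $x\mathrel{R}y \Leftrightarrow f(x)\mathrel{S}f(y)$; $R<_{pr}S$ means $R\leq_{pr}S$ and $S\not\leq_{pr}R$; $R\equiv_{pr}S$ means $R\leq_{pr}S$ and $S\leq_{pr}R$. $\mathbf{Peq}$ is the partial order of $\equiv_{pr}$-classes of punctual equivalence relations, ordered by the order induced by $\leq_{pr}$. For $Z\subseteq\omega$, $R_Z$ is the equivalence relation given by $x\mathrel{R_Z}y \Leftrightarrow (x,y\in Z \text{ or } x=y)$. In a poset $\langle P,\leq\rangle$, an element $a$ is meet-reducible if there are $b,c>a$ in $P$ such that $a$ is the meet of $b,c$; this is applied to an equivalence relation by referring to its degree in $\mathbf{Peq}$. *)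

theory Defs
  imports "HOL-Algebra.Lattice"
begin

text \<open>
  \<open>primrec_on n f\<close>: the restriction of \<open>f\<close> to lists of length \<open>n\<close> is a primitive recursive
  function of \<open>n\<close> arguments. The values of \<open>f\<close> on lists of any other length carry no meaning.
  In the recursion rule the recursion variable is the first argument, and the step function
  receives the recursion variable, the previous value and the parameters, in this order.
\<close>

inductive primrec_on :: "nat \<Rightarrow> (nat list \<Rightarrow> nat) \<Rightarrow> bool" where
  zero: "primrec_on n (\<lambda>_. 0)"
| succ: "primrec_on 1 (\<lambda>xs. Suc (xs ! 0))"
| proj: "i < n \<Longrightarrow> primrec_on n (\<lambda>xs. xs ! i)"
| comp: "primrec_on (length gs) f \<Longrightarrow> \<forall>g\<in>set gs. primrec_on n g \<Longrightarrow>
    primrec_on n (\<lambda>xs. f (map (\<lambda>g. g xs) gs))"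
| prec: "primrec_on n f \<Longrightarrow> primrec_on (n + 2) h \<Longrightarrow>
    primrec_on (n + 1) (\<lambda>xs. rec_nat (f (tl xs)) (\<lambda>k r. h (k # r # tl xs)) (hd xs))"

definition primrec_fun :: "(nat \<Rightarrow> nat) \<Rightarrow> bool" where
  "primrec_fun f \<longleftrightarrow> (\<exists>g. primrec_on 1 g \<and> (\<forall>x. g [x] = f x))"

definition primrec_rel :: "nat rel \<Rightarrow> bool" where
  "primrec_rel R \<longleftrightarrow> (\<exists>g. primrec_on 2 g \<and> (\<forall>x y. g [x, y] = (if (x, y) \<in> R then 1 else 0)))"

definition punctual :: "nat rel \<Rightarrow> bool" where
  "punctual R \<longleftrightarrow> equiv UNIV R \<and> primrec_rel R \<and> infinite (UNIV // R)"

definition pr_le :: "nat rel \<Rightarrow> nat rel \<Rightarrow> bool"  (infix \<open>\<le>\<^sub>p\<^sub>r\<close> 50) where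
  "R \<le>\<^sub>p\<^sub>r S \<longleftrightarrow> (\<exists>f. primrec_fun f \<and> (\<forall>x y. (x, y) \<in> R \<longleftrightarrow> (f x, f y) \<in> S))"

definition pr_less :: "nat rel \<Rightarrow> nat rel \<Rightarrow> bool"  (infix \<open><\<^sub>p\<^sub>r\<close> 50) where
  "R <\<^sub>p\<^sub>r S \<longleftrightarrow> R \<le>\<^sub>p\<^sub>r S \<and> \<not> S \<le>\<^sub>p\<^sub>r R"

definition pr_equiv :: "nat rel rel" where
  "pr_equiv = {(R, S). punctual R \<and> punctual S \<and> R \<le>\<^sub>p\<^sub>r S \<and> S \<le>\<^sub>p\<^sub>r R}"

definition pr_degree :: "nat rel \<Rightarrow> nat rel set" where
  "pr_degree R = pr_equiv `` {R}"

definition Peq :: "nat rel set gorder" where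
  "Peq = \<lparr>carrier = {R. punctual R} // pr_equiv, eq = (=),
          le = (\<lambda>a b. \<exists>R\<in>a. \<exists>S\<in>b. R \<le>\<^sub>p\<^sub>r S)\<rparr>"

definition meet_reducible :: "('a, 'b) gorder_scheme \<Rightarrow> 'a \<Rightarrow> bool" where
  "meet_reducible P a \<longleftrightarrow> a \<in> carrier P \<and>
     (\<exists>b\<in>carrier P. \<exists>c\<in>carrier P. a \<sqsubset>\<^bsub>P\<^esub> b \<and> a \<sqsubset>\<^bsub>P\<^esub> c \<and> is_glb P a {b, c})"

definition R_of :: "nat set \<Rightarrow> nat rel" where
  "R_of Z = {(x, y). (x \<in> Z \<and> y \<in> Z) \<or> x = y}"

lemma pr_le_refl: "R \<le>\<^sub>p\<^sub>r R"
proof -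
  have "primrec_fun (\<lambda>x. x)"
    unfolding primrec_fun_def by (rule exI[of _ "\<lambda>xs. xs ! 0"]) (simp add: primrec_on.proj)
  then show ?thesis
    unfolding pr_le_def by (intro exI[of _ "\<lambda>x. x"]) simp
qed

lemma pr_le_trans:
  assumes "R \<le>\<^sub>p\<^sub>r S" and "S \<le>\<^sub>p\<^sub>r T"
  shows "R \<le>\<^sub>p\<^sub>r T"
proof -
  obtain f where f: "primrec_fun f" "\<forall>x y. (x, y) \<in> R \<longleftrightarrow> (f x, f y) \<in> S"
    using assms(1) unfolding pr_le_def by (elim exE conjE)
  obtain f' where f': "primrec_on 1 f'" "\<forall>x. f' [x] = f x"
    using f(1) unfolding primrec_fun_def by (elim exE conjE)
  obtain h where h: "primrec_fun h" "\<forall>x y. (x, y) \<in> S \<longleftrightarrow> (h x, h y) \<in> T"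
    using assms(2) unfolding pr_le_def by (elim exE conjE)
  obtain h' where h': "primrec_on 1 h'" "\<forall>x. h' [x] = h x"
    using h(1) unfolding primrec_fun_def by (elim exE conjE)
  have "primrec_on 1 (\<lambda>xs. h' (map (\<lambda>g. g xs) [f']))"
    using f'(1) h'(1) by (intro primrec_on.comp) auto
  then have "primrec_fun (\<lambda>x. h (f x))"
    unfolding primrec_fun_def
    by (rule exI[where x = "\<lambda>xs. h' (map (\<lambda>g. g xs) [f'])", OF conjI]) (simp add: f'(2) h'(2))
  then show ?thesis
    unfolding pr_le_def using f(2) h(2) by (intro exI[of _ "\<lambda>x. h (f x)"]) simp
qed

lemma pr_equiv_equiv: "equiv {R. punctual R} pr_equiv"
proof (rule equivI)
  show "trans pr_equiv"
    unfolding trans_def pr_equiv_def mem_Collect_eq case_prod_conv using pr_le_trans by metis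
qed (auto simp: pr_equiv_def refl_on_def sym_def pr_le_refl)

lemma pr_degree_eqI:
  assumes "punctual R" "punctual S" "R \<le>\<^sub>p\<^sub>r S" "S \<le>\<^sub>p\<^sub>r R"
  shows "pr_degree R = pr_degree S"
  unfolding pr_degree_def using assms
  by (intro equiv_class_eq[OF pr_equiv_equiv]) (simp add: pr_equiv_def)

lemma Peq_le_iff:
  assumes "punctual R" "punctual S"
  shows "pr_degree R \<sqsubseteq>\<^bsub>Peq\<^esub> pr_degree S \<longleftrightarrow> R \<le>\<^sub>p\<^sub>r S"
proof
  assume "pr_degree R \<sqsubseteq>\<^bsub>Peq\<^esub> pr_degree S"
  then obtain R' S' where "R \<le>\<^sub>p\<^sub>r R'" "R' \<le>\<^sub>p\<^sub>r S'" "S' \<le>\<^sub>p\<^sub>r S"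
    by (auto simp: Peq_def pr_degree_def pr_equiv_def)
  then show "R \<le>\<^sub>p\<^sub>r S"
    by (metis pr_le_trans)
next
  assume "R \<le>\<^sub>p\<^sub>r S"
  moreover have "R \<in> pr_degree R" "S \<in> pr_degree S"
    using assms by (simp_all add: pr_degree_def pr_equiv_def pr_le_refl)
  ultimately show "pr_degree R \<sqsubseteq>\<^bsub>Peq\<^esub> pr_degree S"
    by (auto simp: Peq_def)
qed

lemma Peq_carrier: "carrier Peq = pr_degree ` {R. punctual R}"
  by (auto simp: Peq_def pr_degree_def quotient_def)

lemma Peq_carrierE:
  assumes "a \<in> carrier Peq"
  obtains R where "punctual R" "a = pr_degree R"
  using assms by (auto simp: Peq_carrier)

lemma Peq_eq: "eq Peq = (=)"
  by (simp add: Peq_def)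

lemma partial_order_Peq: "partial_order Peq"
proof
  fix x y z
  assume "x \<sqsubseteq>\<^bsub>Peq\<^esub> y" "y \<sqsubseteq>\<^bsub>Peq\<^esub> z" "x \<in> carrier Peq" "y \<in> carrier Peq" "z \<in> carrier Peq"
  then show "x \<sqsubseteq>\<^bsub>Peq\<^esub> z"
    by (elim Peq_carrierE) (simp add: Peq_le_iff, metis pr_le_trans)
next
  fix x y
  assume "x \<sqsubseteq>\<^bsub>Peq\<^esub> y" "y \<sqsubseteq>\<^bsub>Peq\<^esub> x" "x \<in> carrier Peq" "y \<in> carrier Peq"
  then show "x .=\<^bsub>Peq\<^esub> y"
    by (elim Peq_carrierE) (simp add: Peq_le_iff Peq_eq, rule pr_degree_eqI)
next
  fix x
  assume "x \<in> carrier Peq"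
  then show "x \<sqsubseteq>\<^bsub>Peq\<^esub> x"
    by (elim Peq_carrierE) (simp add: Peq_le_iff pr_le_refl)
qed (simp_all add: Peq_eq)

end

theory Submission
  imports Defs "HOL-Library.Nat_Bijection"
begin

text \<open>
  Reducibility between punctual equivalence relations only depends on how fast new classes appear.
  Let \<open>class_count R x\<close> be the number of classes of \<open>R\<close> that meet \<open>{0..x}\<close>. Then
  \<open>R \<le>\<^sub>p\<^sub>r S\<close> holds if and only if \<open>class_count R x \<le> class_count S (h x)\<close> for some primitive
  recursive \<open>h\<close> and all \<open>x\<close> (\<open>pr_le_iff_class_count\<close>): send the \<open>k\<close>-th class to the \<open>k\<close>-th class.
  Conversely, every unbounded nondecreasing primitive recursive function that starts with \<open>1\<close> and
  grows by at most one in each step is the class count of a punctual equivalence relation (\<open>punctual_fibre_rel\<close>,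
  \<open>class_count_fibre_rel\<close>).

  Let \<open>N\<close> be the class count of \<open>R_of Z\<close>. It is therefore enough to find two such functions \<open>M0\<close>
  and \<open>M1\<close> with pointwise minimum \<open>N\<close>, neither of which is dominated by \<open>N \<circ> h\<close> for a primitive
  recursive \<open>h\<close>. A count dominated by \<open>M0 \<circ> h0\<close> and by \<open>M1 \<circ> h1\<close> is dominated by \<open>N \<circ> h\<close> with
  \<open>h = max h0 h1\<close>, so that the meet of the two degrees is the degree of \<open>R_of Z\<close>.

  The functions \<open>M0\<close> and \<open>M1\<close> take turns. While one of them equals \<open>N\<close>, the other grows by one in
  each step until it exceeds \<open>N \<circ> h\<close> somewhere, for the function \<open>h\<close> under attack; then it stays
  constant until \<open>N\<close> catches up, and the roles are exchanged. The attack succeeds because otherwise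
  \<open>N \<circ> h\<close> would dominate the identity up to a shift, making \<open>Id\<close> reducible to \<open>R_of Z\<close>.

  Success must be recognised by a primitive recursive procedure, uniformly in \<open>h\<close>. Instead of all
  primitive recursive functions it is enough to attack the members \<open>fgh e\<close> of a fast-growing
  hierarchy that dominates them (\<open>primrec_fun_fgh_bounded\<close>). Each member is primitive recursive, and
  so is the relation \<open>fgh e x \<le> y\<close> in all three variables (\<open>pr_fgh_le\<close>); waiting long enough
  replaces the evaluation of \<open>fgh e x\<close>.
\<close>

section \<open>Closure properties of the primitive recursive functions\<close>

text \<open>
  The inductive predicate sees functions on all lists, although only lists of length \<open>n\<close> matter.
  Identifying functions that agree on those lists makes \<open>pr n\<close> closed under pointwise equality.
  Bound variables, as in sums and bounded quantifiers, are treated like de Bruijn indices: they are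
  put in front of the arguments, and \<open>drop\<close> recovers the outer context. In this way the rules
  \<open>pr_intros\<close> decide by syntax alone that a concrete expression is primitive recursive.
\<close>

definition pr :: "nat \<Rightarrow> (nat list \<Rightarrow> nat) \<Rightarrow> bool" where
  "pr n f \<longleftrightarrow> (\<exists>g. primrec_on n g \<and> (\<forall>xs. length xs = n \<longrightarrow> g xs = f xs))"

abbreviation pr_pred :: "nat \<Rightarrow> (nat list \<Rightarrow> bool) \<Rightarrow> bool" where
  "pr_pred n P \<equiv> pr n (\<lambda>xs. of_bool (P xs))"

named_theorems pr_intros

lemma pr_cong:
  assumes "pr n f" and "\<And>xs. length xs = n \<Longrightarrow> f xs = g xs"
  shows "pr n g"
  using assms unfolding pr_def by metis

lemma pr_compose:
  assumes "pr (length gs) f" and "\<forall>g\<in>set gs. pr n g"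
  shows "pr n (\<lambda>xs. f (map (\<lambda>g. g xs) gs))"
proof -
  obtain f' where f': "primrec_on (length gs) f'" "\<And>ys. length ys = length gs \<Longrightarrow> f' ys = f ys"
    using assms(1) unfolding pr_def by blast
  have "\<forall>g\<in>set gs. \<exists>g'. primrec_on n g' \<and> (\<forall>xs. length xs = n \<longrightarrow> g' xs = g xs)"
    using assms(2) unfolding pr_def .
  then obtain c where c: "\<forall>g\<in>set gs. primrec_on n (c g) \<and> (\<forall>xs. length xs = n \<longrightarrow> c g xs = g xs)"
    by (rule bchoice[THEN exE])
  have "primrec_on n (\<lambda>xs. f' (map (\<lambda>g. g xs) (map c gs)))"
    by (rule primrec_on.comp) (use f'(1) c in auto)
  moreover have "f' (map (\<lambda>g. g xs) (map c gs)) = f (map (\<lambda>g. g xs) gs)" if "length xs = n" for xs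
  proof -
    have "map (\<lambda>g. g xs) (map c gs) = map (\<lambda>g. g xs) gs"
      using c that by simp
    then show ?thesis by (metis f'(2) length_map)
  qed
  ultimately show ?thesis unfolding pr_def by blast
qed

lemma pr_nth: "i < n \<Longrightarrow> pr n (\<lambda>xs. xs ! i)"
  unfolding pr_def using primrec_on.proj by blast

lemma pr_nth_drop: "k + i < n \<Longrightarrow> pr n (\<lambda>xs. drop k xs ! i)"
  by (rule pr_cong[OF pr_nth[of "k + i"]]) simp_all

lemma pr_nth_drop_drop: "k + l + i < n \<Longrightarrow> pr n (\<lambda>xs. drop k (drop l xs) ! i)"
  by (rule pr_cong[OF pr_nth_drop[of "k + l" i]]) simp_all

lemmas [pr_intros] = pr_nth pr_nth_drop pr_nth_drop_drop

text \<open>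
  Weakening of the context, used for functions that ignore the innermost bound variables.
\<close>

lemma pr_drop:
  assumes "pr n f"
  shows "pr (k + n) (\<lambda>ys. f (drop k ys))"
proof -
  have "pr (k + n) (\<lambda>ys. f (map (\<lambda>g. g ys) (map (\<lambda>i ys. drop k ys ! i) [0..<n])))"
    by (rule pr_compose) (auto intro: pr_nth_drop assms)
  then show ?thesis
  proof (rule pr_cong)
    fix ys :: "nat list" assume "length ys = k + n"
    then have "map (\<lambda>g. g ys) (map (\<lambda>i ys. drop k ys ! i) [0..<n]) = drop k ys"
      by (intro nth_equalityI) auto
    then show "f (map (\<lambda>g. g ys) (map (\<lambda>i ys. drop k ys ! i) [0..<n])) = f (drop k ys)"
      by simp
  qed
qed

lemma pr_rec:
  assumes f: "pr n f" and h: "pr (Suc (Suc n)) (\<lambda>ys. h (ys ! 0) (ys ! 1) (drop 2 ys))"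
    and m: "pr n m"
  shows "pr n (\<lambda>xs. rec_nat (f xs) (\<lambda>k r. h k r xs) (m xs))"
proof -
  obtain f' where f': "primrec_on n f'" "\<And>xs. length xs = n \<Longrightarrow> f' xs = f xs"
    using f unfolding pr_def by blast
  obtain h' where h': "primrec_on (n + 2) h'"
    "\<And>ys. length ys = n + 2 \<Longrightarrow> h' ys = h (ys ! 0) (ys ! 1) (drop 2 ys)"
    using h unfolding pr_def by auto
  let ?r = "\<lambda>xs. rec_nat (f' (tl xs)) (\<lambda>k r. h' (k # r # tl xs)) (hd xs)"
  let ?gs = "m # map (\<lambda>i xs. xs ! i) [0..<n]"
  have "pr (length ?gs) ?r"
    unfolding pr_def using primrec_on.prec[OF f'(1) h'(1)] by auto
  then have "pr n (\<lambda>xs. ?r (map (\<lambda>g. g xs) ?gs))"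
    by (rule pr_compose) (use m pr_nth in auto)
  moreover have "?r (map (\<lambda>g. g xs) ?gs) = rec_nat (f xs) (\<lambda>k r. h k r xs) (m xs)"
    if len: "length xs = n" for xs
  proof -
    have eq: "map (\<lambda>g. g xs) ?gs = m xs # xs"
      using len by (auto simp: comp_def intro: map_nth)
    have "rec_nat (f' xs) (\<lambda>k r. h' (k # r # xs)) j = rec_nat (f xs) (\<lambda>k r. h k r xs) j" for j
      by (induction j) (simp_all add: f'(2) h'(2) len)
    then show ?thesis unfolding eq by simp
  qed
  ultimately show ?thesis by (rule pr_cong)
qed

lemma pr_comp1:
  assumes "pr 1 (\<lambda>xs. F (xs ! 0))" "pr n f"
  shows "pr n (\<lambda>xs. F (f xs))"
  using pr_compose[of "[f]" "\<lambda>xs. F (xs ! 0)" n] assms by simp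

lemma pr_comp2:
  assumes "pr 2 (\<lambda>xs. F (xs ! 0) (xs ! 1))" "pr n f" "pr n g"
  shows "pr n (\<lambda>xs. F (f xs) (g xs))"
  using pr_compose[of "[f, g]" "\<lambda>xs. F (xs ! 0) (xs ! 1)" n] assms by (simp add: numeral_2_eq_2)

lemma pr_comp3:
  assumes "pr 3 (\<lambda>xs. F (xs ! 0) (xs ! 1) (xs ! 2))" "pr n f" "pr n g" "pr n h"
  shows "pr n (\<lambda>xs. F (f xs) (g xs) (h xs))"
  using pr_compose[of "[f, g, h]" "\<lambda>xs. F (xs ! 0) (xs ! 1) (xs ! 2)" n] assms
  by (simp add: numeral_2_eq_2 numeral_3_eq_3)

lemma pr_Suc [pr_intros]: "pr n f \<Longrightarrow> pr n (\<lambda>xs. Suc (f xs))"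
  by (rule pr_comp1) (use primrec_on.succ pr_def in auto)

lemma pr_const [pr_intros]: "pr n (\<lambda>_. c)"
proof (induction c)
  case 0
  show ?case unfolding pr_def using primrec_on.zero by blast
next
  case (Suc c)
  then show ?case by (rule pr_Suc)
qed

lemma pr_add [pr_intros]:
  assumes "pr n f" "pr n g"
  shows "pr n (\<lambda>xs. f xs + g xs)"
proof -
  have "pr n (\<lambda>xs. rec_nat (f xs) (\<lambda>_ r. Suc r) (g xs))"
    by (intro pr_rec pr_intros assms) simp_all
  moreover have "rec_nat a (\<lambda>_ r. Suc r) b = a + b" for a b :: nat
    by (induction b) auto
  ultimately show ?thesis by simp
qed

lemma pr_mult [pr_intros]:
  assumes "pr n f" "pr n g"
  shows "pr n (\<lambda>xs. f xs * g xs)"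
proof (rule pr_comp2[OF _ assms])
  have "pr 2 (\<lambda>xs. rec_nat 0 (\<lambda>_ r. r + xs ! 0) (xs ! 1))"
    by (intro pr_rec pr_intros) simp_all
  moreover have "rec_nat 0 (\<lambda>_ r. r + a) b = a * b" for a b :: nat
    by (induction b) auto
  ultimately show "pr 2 (\<lambda>xs. xs ! 0 * xs ! 1)" by simp
qed

lemma pr_minus_1:
  assumes "pr n f"
  shows "pr n (\<lambda>xs. f xs - 1)"
proof (rule pr_comp1[OF _ assms])
  have "pr 1 (\<lambda>xs. rec_nat 0 (\<lambda>k _. k) (xs ! 0))"
    by (intro pr_rec pr_intros) simp_all
  moreover have "rec_nat 0 (\<lambda>k _. k) a = a - 1" for a :: nat
    by (cases a) auto
  ultimately show "pr 1 (\<lambda>xs. xs ! 0 - 1)" by simp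
qed

lemma pr_diff [pr_intros]:
  assumes "pr n f" "pr n g"
  shows "pr n (\<lambda>xs. f xs - g xs)"
proof (rule pr_comp2[OF _ assms])
  have "pr 2 (\<lambda>xs. rec_nat (xs ! 0) (\<lambda>_ r. r - 1) (xs ! 1))"
    by (intro pr_rec pr_minus_1 pr_intros) simp_all
  moreover have "rec_nat a (\<lambda>_ r. r - 1) b = a - b" for a b :: nat
    by (induction b) auto
  ultimately show "pr 2 (\<lambda>xs. xs ! 0 - xs ! 1)" by simp
qed

text \<open>
  Primitive recursion binds two variables, a sum or a minimum only one; the second is skipped.
\<close>

lemma pr_skip_second:
  assumes "pr (Suc n) (\<lambda>ys. f (ys ! 0) (drop 1 ys))"
  shows "pr (Suc (Suc n)) (\<lambda>ys. f (ys ! 0) (drop 2 ys))"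
proof -
  let ?gs = "(\<lambda>ys. ys ! 0) # map (\<lambda>i ys. drop 2 ys ! i) [0..<n]"
  have "pr (Suc (Suc n)) (\<lambda>ys. (\<lambda>zs. f (zs ! 0) (drop 1 zs)) (map (\<lambda>g. g ys) ?gs))" (is "pr _ ?G")
    by (rule pr_compose) (use assms in \<open>auto intro: pr_nth pr_nth_drop\<close>)
  then show ?thesis
  proof (rule pr_cong)
    fix ys :: "nat list" assume "length ys = Suc (Suc n)"
    then have "map (\<lambda>g. g ys) (map (\<lambda>i ys. drop 2 ys ! i) [0..<n]) = drop 2 ys"
      by (intro nth_equalityI) auto
    then show "?G ys = f (ys ! 0) (drop 2 ys)"
      by simp
  qed
qed

lemma pr_sum [pr_intros]:
  assumes "pr n m" "pr (Suc n) (\<lambda>ys. f (ys ! 0) (drop 1 ys))"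
  shows "pr n (\<lambda>xs. \<Sum>i<m xs. f i xs)"
proof -
  have "pr n (\<lambda>xs. rec_nat 0 (\<lambda>k r. r + f k xs) (m xs))"
    by (intro pr_rec assms(1) pr_skip_second[OF assms(2)] pr_intros) simp_all
  moreover have "rec_nat 0 (\<lambda>k r. r + F k) b = (\<Sum>i<b. F i)" for F :: "nat \<Rightarrow> nat" and b
    by (induction b) auto
  ultimately show ?thesis by simp
qed

lemma pr_not [pr_intros]:
  assumes "pr_pred n P"
  shows "pr_pred n (\<lambda>xs. \<not> P xs)"
proof -
  have "pr n (\<lambda>xs. 1 - of_bool (P xs))" by (intro pr_intros assms)
  then show ?thesis by (rule pr_cong) simp
qed

lemma pr_conj [pr_intros]:
  assumes "pr_pred n P" "pr_pred n Q"
  shows "pr_pred n (\<lambda>xs. P xs \<and> Q xs)"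
proof -
  have "pr n (\<lambda>xs. of_bool (P xs) * of_bool (Q xs))" by (intro pr_intros assms)
  then show ?thesis by (rule pr_cong) simp
qed

lemma pr_disj [pr_intros]:
  assumes "pr_pred n P" "pr_pred n Q"
  shows "pr_pred n (\<lambda>xs. P xs \<or> Q xs)"
proof -
  have "pr_pred n (\<lambda>xs. \<not> (\<not> P xs \<and> \<not> Q xs))" by (intro pr_intros assms)
  then show ?thesis by simp
qed

lemma pr_less [pr_intros]:
  assumes "pr n f" "pr n g"
  shows "pr_pred n (\<lambda>xs. f xs < g xs)"
proof -
  have "pr n (\<lambda>xs. 1 - (1 - (g xs - f xs)))" by (intro pr_intros assms)
  then show ?thesis by (rule pr_cong) auto
qed

lemma pr_le [pr_intros]:
  assumes "pr n f" "pr n g"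
  shows "pr_pred n (\<lambda>xs. f xs \<le> g xs)"
  using pr_less[OF assms(1) pr_Suc[OF assms(2)]] by (simp add: less_Suc_eq_le)

lemma pr_eq [pr_intros]:
  assumes "pr n f" "pr n g"
  shows "pr_pred n (\<lambda>xs. f xs = g xs)"
  unfolding eq_iff by (intro pr_intros assms)

lemma pr_ex_less [pr_intros]:
  assumes "pr n m" "pr_pred (Suc n) (\<lambda>ys. P (ys ! 0) (drop 1 ys))"
  shows "pr_pred n (\<lambda>xs. \<exists>i<m xs. P i xs)"
proof -
  have "pr_pred n (\<lambda>xs. 0 < (\<Sum>i<m xs. of_bool (P i xs) :: nat))" by (intro pr_intros assms)
  then show ?thesis by (rule pr_cong) (auto simp: Bex_def)
qed

lemma pr_all_less [pr_intros]:
  assumes "pr n m" "pr_pred (Suc n) (\<lambda>ys. P (ys ! 0) (drop 1 ys))"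
  shows "pr_pred n (\<lambda>xs. \<forall>i<m xs. P i xs)"
proof -
  have "pr_pred n (\<lambda>xs. \<not> (\<exists>i<m xs. \<not> P i xs))" by (intro pr_intros assms)
  then show ?thesis by simp
qed

lemma pr_if [pr_intros]:
  assumes "pr_pred n P" "pr n f" "pr n g"
  shows "pr n (\<lambda>xs. if P xs then f xs else g xs)"
proof -
  have "pr n (\<lambda>xs. of_bool (P xs) * f xs + of_bool (\<not> P xs) * g xs)" by (intro pr_intros assms)
  then show ?thesis by (rule pr_cong) simp
qed

lemma pr_max [pr_intros]: "pr n f \<Longrightarrow> pr n g \<Longrightarrow> pr n (\<lambda>xs. max (f xs) (g xs))"
  unfolding max_def by (intro pr_intros)

text \<open>
  A quotient is a number of multiples, hence a bounded sum of characteristic functions.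
\<close>

lemma div_nat_eq_sum:
  fixes a b :: nat
  assumes "0 < b"
  shows "a div b = (\<Sum>i<a. of_bool (b * Suc i \<le> a))"
proof -
  have "(\<Sum>i<a. of_bool (b * Suc i \<le> a)) = (\<Sum>i<a. if i < a div b then 1 else 0)"
    by (rule sum.cong)
      (use assms in \<open>auto simp: Suc_le_eq[symmetric] less_eq_div_iff_mult_less_eq mult.commute\<close>)
  also have "\<dots> = card ({..<a} \<inter> {i. i < a div b})"
    by (simp add: sum.If_cases)
  also have "{..<a} \<inter> {i. i < a div b} = {..<a div b}"
    using div_le_dividend[of a b] by (auto simp del: div_le_dividend)
  finally show ?thesis by simp
qed

lemma pr_div_const [pr_intros]:
  assumes "pr n f"
  shows "pr n (\<lambda>xs. f xs div numeral b)"
  by (rule pr_comp1[OF _ assms], subst div_nat_eq_sum) (simp, intro pr_intros, simp_all)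

lemma pr_mod_const [pr_intros]: "pr n f \<Longrightarrow> pr n (\<lambda>xs. f xs mod numeral b)"
  unfolding minus_mult_div_eq_mod[symmetric] by (intro pr_intros)

lemma pr_prod_encode [pr_intros]:
  assumes "pr n f" "pr n g"
  shows "pr n (\<lambda>xs. prod_encode (f xs, g xs))"
proof -
  have "triangle k = (\<Sum>i<Suc k. i)" for k
    by (induction k) auto
  then have "prod_encode (a, b) = (\<Sum>i<Suc (a + b). i) + a" for a b
    by (simp add: prod_encode_def)
  then show ?thesis
    by (simp only:) (intro pr_intros assms, simp_all)
qed

text \<open>
  A component of a pair is bounded by the code of the pair, so decoding is a bounded search, here
  written as a sum with a single nonzero term.
\<close>

lemma pr_prod_decode [pr_intros]:
  assumes "pr n f"
  shows "pr n (\<lambda>xs. fst (prod_decode (f xs)))" "pr n (\<lambda>xs. snd (prod_decode (f xs)))"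
proof -
  have eq: "h (prod_decode c) = (\<Sum>a<Suc c. \<Sum>b<Suc c. of_bool (prod_encode (a, b) = c) * h (a, b))"
    for h :: "nat \<times> nat \<Rightarrow> nat" and c
  proof -
    obtain u v where c: "prod_encode (u, v) = c"
      by (metis prod_decode_inverse surj_pair)
    then have "(\<Sum>a<Suc c. \<Sum>b<Suc c. of_bool (prod_encode (a, b) = c) * h (a, b))
      = (\<Sum>p\<in>{..<Suc c} \<times> {..<Suc c}. of_bool (prod_encode p = prod_encode (u, v)) * h p)"
      by (simp only: sum.cartesian_product case_prod_unfold prod.collapse)
    also have "\<dots> = (\<Sum>p\<in>{..<Suc c} \<times> {..<Suc c}. if p = (u, v) then h p else 0)"
      by (rule sum.cong) (auto simp: prod_encode_eq)
    also have "\<dots> = h (u, v)"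
      using le_prod_encode_1[of u v] le_prod_encode_2[of v u] by (simp add: c less_Suc_eq_le)
    finally show ?thesis using c by (metis prod_encode_inverse)
  qed
  show "pr n (\<lambda>xs. fst (prod_decode (f xs)))"
    unfolding eq[of fst] fst_conv by (rule pr_comp1[OF _ assms]) (intro pr_intros, simp_all)
  show "pr n (\<lambda>xs. snd (prod_decode (f xs)))"
    unfolding eq[of snd] snd_conv by (rule pr_comp1[OF _ assms]) (intro pr_intros, simp_all)
qed

section \<open>A fast-growing hierarchy\<close>

text \<open>
  A variant of the Ackermann hierarchy. The iteration count \<open>x + 2\<close> leaves room for any two
  compositions and for the \<open>x + 1\<close> iterates that a recursion up to \<open>x\<close> needs, so that
  composition and primitive recursion each cost one index; and it equals the number of copies that
  the stack machine below pushes at time \<open>x\<close>.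
\<close>

primrec fgh :: "nat \<Rightarrow> nat \<Rightarrow> nat" where
  "fgh 0 = Suc"
| "fgh (Suc e) = (\<lambda>x. (fgh e ^^ (x + 2)) (Suc x))"

lemma le_funpow:
  fixes f :: "nat \<Rightarrow> nat"
  assumes "\<And>x. x \<le> f x"
  shows "x \<le> (f ^^ n) x"
  by (induction n) (auto intro: order_trans assms)

lemma funpow_le_funpow:
  fixes f :: "nat \<Rightarrow> nat"
  assumes "mono f" "\<And>x. x \<le> f x" "m \<le> n" "x \<le> y"
  shows "(f ^^ m) x \<le> (f ^^ n) y"
proof -
  have "(f ^^ m) x \<le> (f ^^ m) y"
    using assms(1,4) by (rule funpow_mono)
  also have "\<dots> \<le> (f ^^ (n - m)) ((f ^^ m) y)"
    by (rule le_funpow) (rule assms)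
  also have "\<dots> = (f ^^ n) y"
    using assms(3) by (metis add.commute funpow_add le_add_diff_inverse2 o_apply)
  finally show ?thesis .
qed

lemma less_fgh: "x < fgh e x"
proof (induction e arbitrary: x)
  case (Suc e)
  have "Suc x \<le> (fgh e ^^ (x + 2)) (Suc x)"
    by (rule le_funpow) (simp add: Suc less_imp_le)
  then show ?case by simp
qed simp

lemma mono_fgh: "mono (fgh e)"
proof (induction e)
  case (Suc e)
  show ?case
    by (rule monoI) (simp del: funpow.simps, rule funpow_le_funpow[OF Suc],
        auto simp: less_imp_le[OF less_fgh])
qed (simp add: mono_def)

lemma funpow_fgh_le:
  assumes "k \<le> v + 2"
  shows "(fgh e ^^ k) v \<le> fgh (Suc e) v"
  using funpow_le_funpow[OF mono_fgh[of e], of k "v + 2" v "Suc v"] assms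
  by (auto simp: less_imp_le[OF less_fgh] simp del: funpow.simps)

lemma fgh_mono_index: "d \<le> e \<Longrightarrow> fgh d x \<le> fgh e x"
proof (induction e rule: dec_induct)
  case (step e)
  show ?case using step.IH funpow_fgh_le[of 1 x e] by simp
qed simp

text \<open>
  The bound refers to any upper bound \<open>v\<close> of the arguments instead of their maximum, which makes
  it monotone in the arguments although \<open>f\<close> need not be.
\<close>

definition fgh_bounded :: "nat \<Rightarrow> (nat list \<Rightarrow> nat) \<Rightarrow> nat \<Rightarrow> bool" where
  "fgh_bounded n f e \<longleftrightarrow> (\<forall>xs v. length xs = n \<longrightarrow> (\<forall>x\<in>set xs. x \<le> v) \<longrightarrow> f xs \<le> fgh e v)"

lemma fgh_bounded_mono: "fgh_bounded n f d \<Longrightarrow> d \<le> e \<Longrightarrow> fgh_bounded n f e"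
  unfolding fgh_bounded_def using fgh_mono_index order_trans by blast

text \<open>
  Composition is absorbed by one further index because \<open>fgh m (fgh m v)\<close> is an iterate below
  \<open>fgh (Suc m) v\<close>. In a recursion the \<open>k\<close>-th value is at most the \<open>k + 1\<close>-st iterate of
  \<open>fgh m\<close> at \<open>v\<close>, and \<open>k \<le> v\<close> since the recursion variable is one of the arguments.
\<close>

lemma primrec_on_fgh_bounded: "primrec_on n f \<Longrightarrow> \<exists>e. fgh_bounded n f e"
proof (induction rule: primrec_on.induct)
  case (zero n)
  then show ?case by (simp add: fgh_bounded_def)
next
  case succ
  have "fgh_bounded 1 (\<lambda>xs. Suc (xs ! 0)) 0"
    by (auto simp: fgh_bounded_def)
  then show ?case ..
next
  case (proj i n)
  then have "fgh_bounded n (\<lambda>xs. xs ! i) 0"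
    by (auto simp: fgh_bounded_def intro: le_SucI)
  then show ?case ..
next
  case (comp gs f n)
  then obtain a where a: "fgh_bounded (length gs) f a" by blast
  have "\<forall>g\<in>set gs. \<exists>e. fgh_bounded n g e" using comp.IH by blast
  then obtain c where c: "\<forall>g\<in>set gs. fgh_bounded n g (c g)" by (rule bchoice[THEN exE])
  define m where "m = Max (insert a (c ` set gs))"
  have am: "a \<le> m" and cm: "g \<in> set gs \<Longrightarrow> c g \<le> m" for g
    by (simp_all add: m_def)
  have "fgh_bounded n (\<lambda>xs. f (map (\<lambda>g. g xs) gs)) (Suc m)"
    unfolding fgh_bounded_def
  proof (intro allI impI)
    fix xs :: "nat list" and v assume xs: "length xs = n" "\<forall>x\<in>set xs. x \<le> v"
    have "g xs \<le> fgh m v" if "g \<in> set gs" for g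
      using fgh_bounded_mono[OF _ cm[OF that]] c that xs unfolding fgh_bounded_def by blast
    then have "f (map (\<lambda>g. g xs) gs) \<le> fgh m (fgh m v)"
      using fgh_bounded_mono[OF a am] unfolding fgh_bounded_def by simp
    also have "\<dots> \<le> fgh (Suc m) v"
      using funpow_fgh_le[of 2 v m] by (simp add: numeral_2_eq_2)
    finally show "f (map (\<lambda>g. g xs) gs) \<le> fgh (Suc m) v" .
  qed
  then show ?case ..
next
  case (prec n f h)
  then obtain a b where "fgh_bounded n f a" "fgh_bounded (n + 2) h b" by blast
  then have ab: "fgh_bounded n f (max a b)" "fgh_bounded (n + 2) h (max a b)"
    by (auto elim: fgh_bounded_mono)
  define m where "m = max a b"
  have "fgh_bounded (n + 1) (\<lambda>xs. rec_nat (f (tl xs)) (\<lambda>k r. h (k # r # tl xs)) (hd xs)) (Suc m)"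
    unfolding fgh_bounded_def
  proof (intro allI impI)
    fix xs :: "nat list" and v assume xs: "length xs = n + 1" "\<forall>x\<in>set xs. x \<le> v"
    then obtain y ys where xs_eq: "xs = y # ys" and ys: "length ys = n" "y \<le> v" "\<forall>x\<in>set ys. x \<le> v"
      by (cases xs) auto
    let ?r = "rec_nat (f ys) (\<lambda>k r. h (k # r # ys))"
    have "k \<le> v \<Longrightarrow> ?r k \<le> (fgh m ^^ Suc k) v" for k
    proof (induction k)
      case 0
      then show ?case using ab(1) ys by (simp add: fgh_bounded_def m_def)
    next
      case (Suc k)
      have "v \<le> (fgh m ^^ Suc k) v"
        by (rule le_funpow) (simp add: less_imp_le[OF less_fgh])
      then have "\<forall>x\<in>set (k # ?r k # ys). x \<le> (fgh m ^^ Suc k) v"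
        using Suc ys by auto
      then have "h (k # ?r k # ys) \<le> fgh m ((fgh m ^^ Suc k) v)"
        using ab(2) ys unfolding fgh_bounded_def m_def by auto
      then show ?case by simp
    qed
    then have "?r y \<le> (fgh m ^^ Suc y) v" using ys by blast
    also have "\<dots> \<le> fgh (Suc m) v"
      using ys by (intro funpow_fgh_le) simp
    finally show "rec_nat (f (tl xs)) (\<lambda>k r. h (k # r # tl xs)) (hd xs) \<le> fgh (Suc m) v"
      by (simp add: xs_eq)
  qed
  then show ?case ..
qed

lemma primrec_fun_fgh_bounded:
  assumes "primrec_fun h"
  obtains e where "\<And>x. h x \<le> fgh e x"
proof -
  obtain g where g: "primrec_on 1 g" "\<forall>x. g [x] = h x"
    using assms unfolding primrec_fun_def by blast
  obtain e where e: "fgh_bounded 1 g e"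
    using primrec_on_fgh_bounded[OF g(1)] by blast
  have "h x \<le> fgh e x" for x
    using e[unfolded fgh_bounded_def, rule_format, of "[x]" x] g(2) by simp
  then show ?thesis by (rule that)
qed

lemma primrec_fun_iff_pr: "primrec_fun f \<longleftrightarrow> pr 1 (\<lambda>xs. f (xs ! 0))"
proof
  assume "primrec_fun f"
  then obtain g where g: "primrec_on 1 g" "\<forall>x. g [x] = f x"
    unfolding primrec_fun_def by blast
  have "g xs = f (xs ! 0)" if "length xs = 1" for xs
    using that g(2) by (cases xs) auto
  then show "pr 1 (\<lambda>xs. f (xs ! 0))"
    using g(1) unfolding pr_def by blast
next
  assume "pr 1 (\<lambda>xs. f (xs ! 0))"
  then obtain g where "primrec_on 1 g" "\<And>xs. length xs = 1 \<Longrightarrow> g xs = f (xs ! 0)"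
    unfolding pr_def by blast
  then show "primrec_fun f"
    unfolding primrec_fun_def by (intro exI[of _ g]) simp
qed

lemma pr_funpow [pr_intros]:
  assumes "pr n a" "pr n m" "pr (Suc n) (\<lambda>ys. f (ys ! 0) (drop 1 ys))"
  shows "pr n (\<lambda>xs. ((\<lambda>r. f r xs) ^^ m xs) (a xs))"
proof -
  have "pr (1 + Suc n) (\<lambda>ys. f (drop 1 ys ! 0) (drop 1 (drop 1 ys)))"
    using pr_drop[OF assms(3), of 1] .
  then have "pr (Suc (Suc n)) (\<lambda>ys. f (drop 1 ys ! 0) (drop 1 (drop 1 ys)))"
    by simp
  then have "pr (Suc (Suc n)) (\<lambda>ys. f (ys ! 1) (drop 2 ys))"
    by (rule pr_cong) (simp add: numeral_2_eq_2)
  then have "pr n (\<lambda>xs. rec_nat (a xs) (\<lambda>_ r. f r xs) (m xs))"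
    by (intro pr_rec assms)
  moreover have "rec_nat b (\<lambda>_ r. g r) k = (g ^^ k) b" for b :: nat and g k
    by (induction k) auto
  ultimately show ?thesis by simp
qed

text \<open>
  Each index adds one recursion to the derivation; this is not uniform in \<open>e\<close>.
\<close>

lemma pr_fgh_index:
  assumes "pr n f"
  shows "pr n (\<lambda>xs. fgh e (f xs))"
proof (rule pr_comp1[OF _ assms], induction e)
  case (Suc e)
  have "pr 1 (\<lambda>xs. ((\<lambda>r. fgh e r) ^^ (xs ! 0 + 2)) (Suc (xs ! 0)))"
    by (intro pr_funpow pr_intros pr_comp1[OF Suc]) simp_all
  then show ?case by simp
qed (simp, intro pr_intros, simp)

section \<open>The graph of the hierarchy is primitive recursive\<close>

text \<open>
  The hierarchy as a whole grows too fast to be primitive recursive, but the relation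
  \<open>fgh e x \<le> y\<close> in all three variables is. It is decided by a machine that works in real time:
  a stack of indices, of which the top one is removed at each time \<open>t\<close>. An index \<open>0\<close> costs just
  this time unit, and \<open>Suc j\<close> is replaced by \<open>t + 2\<close> copies of \<open>j\<close>, following the recursion for
  \<open>fgh\<close>. Started at time \<open>x\<close> with the single index \<open>e\<close>, the stack is emptied at time \<open>fgh e x\<close>.
\<close>

fun stack_step :: "nat \<Rightarrow> nat list \<Rightarrow> nat list" where
  "stack_step t [] = []"
| "stack_step t (0 # st) = st"
| "stack_step t (Suc j # st) = replicate (t + 2) j @ st"

definition stack_run :: "nat \<Rightarrow> nat \<Rightarrow> nat \<Rightarrow> nat list" where
  "stack_run e x = rec_nat [e] (\<lambda>i. stack_step (x + i))"

text \<open>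
  The time at which a stack present at time \<open>t\<close> will be empty, computed without running the machine.
  It is invariant under steps of the machine and equals the current time only for the empty stack.
\<close>

fun clear_time :: "nat \<Rightarrow> nat list \<Rightarrow> nat" where
  "clear_time t [] = t"
| "clear_time t (e # st) = clear_time (fgh e t) st"

lemma clear_time_ge: "t \<le> clear_time t st"
proof (induction st arbitrary: t)
  case (Cons e st)
  show ?case using less_imp_le[OF less_fgh[of t e]] Cons[of "fgh e t"] by simp
qed simp

lemma clear_time_eq_iff: "clear_time t st = t \<longleftrightarrow> st = []"
proof (cases st)
  case (Cons e st')
  then show ?thesis using less_fgh[of t e] clear_time_ge[of "fgh e t" st'] by simp
qed simp

lemma clear_time_replicate: "clear_time t (replicate k e @ st) = clear_time ((fgh e ^^ k) t) st"
  by (induction k arbitrary: t) (simp_all add: funpow_swap1)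

lemma clear_time_stack_step: "st \<noteq> [] \<Longrightarrow> clear_time (Suc t) (stack_step t st) = clear_time t st"
  by (cases "(t, st)" rule: stack_step.cases)
    (auto simp: clear_time_replicate simp del: funpow.simps replicate.simps)

lemma clear_time_stack_run: "x + i \<le> fgh e x \<Longrightarrow> clear_time (x + i) (stack_run e x i) = fgh e x"
proof (induction i)
  case (Suc i)
  then have "stack_run e x i \<noteq> []"
    using clear_time_eq_iff[of "x + i" "stack_run e x i"] by auto
  then show ?case
    using Suc clear_time_stack_step[of "stack_run e x i" "x + i"] by (simp add: stack_run_def)
qed (simp add: stack_run_def)

lemma stack_run_empty_iff: "stack_run e x i = [] \<longleftrightarrow> fgh e x \<le> x + i"
proof (cases "x + i < fgh e x")
  case True
  then show ?thesis
    using clear_time_stack_run[of x i e] clear_time_eq_iff[of "x + i" "stack_run e x i"] by simp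
next
  case False
  define j where "j = fgh e x - x"
  have j: "x + j = fgh e x" using less_fgh[of x e] by (simp add: j_def)
  then have "stack_run e x j = []"
    using clear_time_stack_run[of x j e] clear_time_eq_iff[of "x + j" "stack_run e x j"] by simp
  moreover have "j \<le> i" using False j by simp
  from this calculation have "stack_run e x i = []"
    by (induction i rule: dec_induct) (simp_all add: stack_run_def)
  then show ?thesis using False by simp
qed

text \<open>
  The action of \<open>stack_step\<close> on codes: the empty stack has code \<open>0\<close>, and pushing is
  \<open>list_encode (j # st) = Suc (prod_encode (j, list_encode st))\<close>.
\<close>

definition code_step :: "nat \<Rightarrow> nat \<Rightarrow> nat" where
  "code_step t c =
    (let j = fst (prod_decode (c - 1)); r = snd (prod_decode (c - 1)) in
     if c = 0 then 0 else if j = 0 then r else ((\<lambda>s. Suc (prod_encode (j - 1, s))) ^^ (t + 2)) r)"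

lemma code_step_encode: "code_step t (list_encode st) = list_encode (stack_step t st)"
proof (cases "(t, st)" rule: stack_step.cases)
  case (3 t' j st')
  have "((\<lambda>s. Suc (prod_encode (j, s))) ^^ k) (list_encode st') = list_encode (replicate k j @ st')" for k
    by (induction k) auto
  with 3 show ?thesis by (simp add: code_step_def del: funpow.simps replicate.simps)
qed (simp_all add: code_step_def)

lemma pr_code_step [pr_intros]:
  assumes "pr n f" "pr n g"
  shows "pr n (\<lambda>xs. code_step (f xs) (g xs))"
  by (rule pr_comp2[OF _ assms], unfold code_step_def Let_def) (intro pr_intros, simp_all)

text \<open>
  Running the machine for \<open>y - x\<close> steps suffices, so the recursion has a bound known in advance.
\<close>

lemma pr_fgh_le [pr_intros]:
  assumes "pr n f" "pr n g" "pr n h"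
  shows "pr_pred n (\<lambda>xs. fgh (f xs) (g xs) \<le> h xs)"
proof (rule pr_comp3[OF _ assms])
  have eq: "fgh e x \<le> y \<longleftrightarrow>
      x \<le> y \<and> rec_nat (Suc (prod_encode (e, 0))) (\<lambda>i. code_step (x + i)) (y - x) = 0" for e x y
  proof (cases "x \<le> y")
    case True
    have "rec_nat (Suc (prod_encode (e, 0))) (\<lambda>i. code_step (x + i)) i = list_encode (stack_run e x i)" for i
      by (induction i) (simp_all add: stack_run_def code_step_encode)
    moreover have "list_encode st = 0 \<longleftrightarrow> st = []" for st
      by (cases st) auto
    ultimately show ?thesis
      using True by (simp add: stack_run_empty_iff)
  next
    case False
    then show ?thesis using less_fgh[of x e] by simp
  qed
  show "pr_pred 3 (\<lambda>xs. fgh (xs ! 0) (xs ! 1) \<le> xs ! 2)"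
    unfolding eq by (intro pr_intros pr_rec) simp_all
qed

section \<open>Reducibility as domination of class counts\<close>

text \<open>
  Every class is represented by its least element, which a bounded search finds. Classes are
  numbered in the order of these representatives.
\<close>

definition minrep :: "nat rel \<Rightarrow> nat \<Rightarrow> bool" where
  "minrep R y \<longleftrightarrow> (\<forall>z<y. (z, y) \<notin> R)"

definition class_count :: "nat rel \<Rightarrow> nat \<Rightarrow> nat" where
  "class_count R x = card {y. y \<le> x \<and> minrep R y}"

definition class_index :: "nat rel \<Rightarrow> nat \<Rightarrow> nat" where
  "class_index R x = class_count R (LEAST z. (z, x) \<in> R)"

lemma minrep_Least:
  assumes "equiv UNIV R"
  shows "minrep R (LEAST z. (z, x) \<in> R)" "((LEAST z. (z, x) \<in> R), x) \<in> R" "(LEAST z. (z, x) \<in> R) \<le> x"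
proof -
  have refl: "(x, x) \<in> R" using assms by (auto simp: equiv_def refl_on_def)
  show x: "((LEAST z. (z, x) \<in> R), x) \<in> R" using refl by (rule LeastI)
  show "(LEAST z. (z, x) \<in> R) \<le> x" using refl by (rule Least_le)
  show "minrep R (LEAST z. (z, x) \<in> R)"
    unfolding minrep_def
  proof (intro allI impI notI)
    fix z assume z: "z < (LEAST z. (z, x) \<in> R)" "(z, LEAST z. (z, x) \<in> R) \<in> R"
    then have "(z, x) \<in> R" using x assms by (meson equiv_def transD)
    then show False using z(1) not_less_Least by blast
  qed
qed

lemma minrep_unique:
  assumes "equiv UNIV R" "minrep R y" "minrep R z" "(y, z) \<in> R"
  shows "y = z"
  using assms unfolding minrep_def equiv_def by (metis linorder_neqE_nat symD)

lemma Least_rep_eq_iff: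
  fixes R :: "nat rel"
  assumes "equiv UNIV R"
  shows "(LEAST z. (z, x) \<in> R) = (LEAST z. (z, y) \<in> R) \<longleftrightarrow> (x, y) \<in> R"
proof
  assume "(x, y) \<in> R"
  then have "(z, x) \<in> R \<longleftrightarrow> (z, y) \<in> R" for z
    using assms by (meson equiv_def symD transD)
  then show "(LEAST z. (z, x) \<in> R) = (LEAST z. (z, y) \<in> R)" by simp
next
  assume "(LEAST z. (z, x) \<in> R) = (LEAST z. (z, y) \<in> R)"
  then show "(x, y) \<in> R"
    using minrep_Least(2)[of R x] minrep_Least(2)[of R y] assms
    by (metis equiv_def symD transD)
qed

lemma class_count_0: "class_count R 0 = 1"
proof -
  have "{y. y \<le> 0 \<and> minrep R y} = {0}" by (auto simp: minrep_def)
  then show ?thesis by (simp add: class_count_def)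
qed

lemma class_count_Suc: "class_count R (Suc x) = class_count R x + of_bool (minrep R (Suc x))"
proof -
  have "{y. y \<le> Suc x \<and> minrep R y} = {y. y \<le> x \<and> minrep R y} \<union> (if minrep R (Suc x) then {Suc x} else {})"
    by (auto simp: le_Suc_eq)
  then show ?thesis by (simp add: class_count_def)
qed

lemma mono_class_count: "mono (class_count R)"
  by (rule mono_iff_le_Suc[THEN iffD2, rule_format]) (simp add: class_count_Suc)

text \<open>
  The count jumps exactly at the least representatives, so its value there identifies the class.
\<close>

lemma inj_on_class_count_minrep: "inj_on (class_count R) {y. minrep R y}"
proof (rule linorder_inj_onI')
  fix y z assume "y < z" "z \<in> {y. minrep R y}"
  then obtain w where "z = Suc w" "y \<le> w" by (cases z) auto
  then show "class_count R y \<noteq> class_count R z"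
    using \<open>z \<in> _\<close> monoD[OF mono_class_count, of y w R] by (simp add: class_count_Suc)
qed

lemma class_index_eq_iff:
  assumes "equiv UNIV R"
  shows "class_index R x = class_index R y \<longleftrightarrow> (x, y) \<in> R"
proof -
  have "class_index R x = class_index R y \<longleftrightarrow> (LEAST z. (z, x) \<in> R) = (LEAST z. (z, y) \<in> R)"
    unfolding class_index_def using minrep_Least(1)[OF assms]
    by (intro inj_on_eq_iff[OF inj_on_class_count_minrep]) simp_all
  then show ?thesis by (simp only: Least_rep_eq_iff[OF assms])
qed

lemma class_index_le_class_count: "equiv UNIV R \<Longrightarrow> class_index R x \<le> class_count R x"
  unfolding class_index_def by (rule monoD[OF mono_class_count]) (rule minrep_Least)

lemma class_index_pos: "0 < class_index R x"
  unfolding class_index_def using monoD[OF mono_class_count, of 0 _ R] by (simp add: class_count_0 Suc_le_eq)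

lemma minrep_Least_class_count:
  assumes "k \<noteq> 0" "k \<le> class_count R b"
  shows "minrep R (LEAST y. k \<le> class_count R y)" "class_count R (LEAST y. k \<le> class_count R y) = k"
proof -
  define y where "y = (LEAST y. k \<le> class_count R y)"
  have y: "k \<le> class_count R y" unfolding y_def using assms(2) by (rule LeastI)
  have "minrep R y \<and> class_count R y = k"
  proof (cases y)
    case 0
    then show ?thesis using y assms(1) by (simp add: class_count_0 minrep_def)
  next
    case (Suc w)
    then have "\<not> k \<le> class_count R w" unfolding y_def using not_less_Least lessI by metis
    then show ?thesis using y Suc by (cases "minrep R (Suc w)") (simp_all add: class_count_Suc)
  qed
  then show "minrep R (LEAST y. k \<le> class_count R y)" "class_count R (LEAST y. k \<le> class_count R y) = k"
    by (simp_all add: y_def)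
qed

lemma Least_nat_eq_sum:
  fixes P :: "nat \<Rightarrow> bool"
  assumes "P b"
  shows "(LEAST y. P y) = (\<Sum>i<b. of_bool (\<forall>j<Suc i. \<not> P j))"
proof -
  have "{i. i < b \<and> (\<forall>j<Suc i. \<not> P j)} = {..<LEAST y. P y}"
    using Least_le[of P, OF assms] LeastI[of P, OF assms]
    by (auto simp: less_Suc_eq_le dest: not_less_Least)
       (metis leI, metis order_le_less_trans not_less_Least)
  then show ?thesis by (simp add: of_bool_def sum.If_cases Int_def)
qed

lemma pr_Least:
  assumes "pr n m" "pr_pred (Suc n) (\<lambda>ys. P (ys ! 0) (drop 1 ys))"
    and ex: "\<And>xs. length xs = n \<Longrightarrow> P (m xs) xs"
  shows "pr n (\<lambda>xs. LEAST y. P y xs)"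
proof -
  have "pr_pred (Suc (Suc n)) (\<lambda>ys. P (ys ! 0) (drop 2 ys))"
    by (rule pr_skip_second) (rule assms(2))
  then have "pr n (\<lambda>xs. \<Sum>i<m xs. of_bool (\<forall>j<Suc i. \<not> P j xs))"
    by (intro pr_intros assms) (simp_all add: numeral_2_eq_2)
  then show ?thesis
    by (rule pr_cong) (rule Least_nat_eq_sum[symmetric], rule ex)
qed

lemma pr_mem [pr_intros]:
  assumes "primrec_rel R" "pr n f" "pr n g"
  shows "pr_pred n (\<lambda>xs. (f xs, g xs) \<in> R)"
proof (rule pr_comp2[OF _ assms(2,3)])
  obtain g where g: "primrec_on 2 g" "\<forall>x y. g [x, y] = (if (x, y) \<in> R then 1 else 0)"
    using assms(1) unfolding primrec_rel_def by blast
  have "g xs = of_bool ((xs ! 0, xs ! 1) \<in> R)" if "length xs = 2" for xs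
    using that g(2) by (auto simp: length_Suc_conv numeral_2_eq_2)
  then show "pr_pred 2 (\<lambda>xs. (xs ! 0, xs ! 1) \<in> R)"
    using g(1) unfolding pr_def by blast
qed

lemma class_count_eq_sum: "class_count R x = (\<Sum>y<Suc x. of_bool (\<forall>z<y. (z, y) \<notin> R))"
  by (induction x) (simp_all add: class_count_0 class_count_Suc minrep_def)

lemma pr_class_count [pr_intros]:
  assumes "primrec_rel R" "pr n f"
  shows "pr n (\<lambda>xs. class_count R (f xs))"
  unfolding class_count_eq_sum by (rule pr_comp1[OF _ assms(2)]) (intro pr_intros assms(1), simp_all)

lemma pr_class_index [pr_intros]:
  assumes "equiv UNIV R" "primrec_rel R" "pr n f"
  shows "pr n (\<lambda>xs. class_index R (f xs))"
  unfolding class_index_def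
proof (rule pr_comp1[OF _ assms(3)])
  have "pr 1 (\<lambda>xs. LEAST z. (z, xs ! 0) \<in> R)"
    by (rule pr_Least[where m = "\<lambda>xs. xs ! 0"])
      (use assms(1) in \<open>auto simp: equiv_def refl_on_def intro!: pr_intros assms(2)\<close>)
  then show "pr 1 (\<lambda>xs. class_count R (LEAST z. (z, xs ! 0) \<in> R))"
    by (intro pr_intros assms(2))
qed

text \<open>
  This turns the degrees of punctual equivalence relations into a growth-rate order. A reduction
  \<open>f\<close> sends the classes that meet \<open>{0..x}\<close> to distinct classes that meet \<open>{0..h x}\<close>, where
  \<open>h x\<close> bounds the values of \<open>f\<close> up to \<open>x\<close>. Conversely, if the counts are dominated by means of
  \<open>h\<close>, then the \<open>k\<close>-th class of \<open>R\<close> can be sent to the \<open>k\<close>-th class of \<open>S\<close>: if the former has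
  \<open>x\<close> as a member, the latter has a member in \<open>{0..h x}\<close>, so the search for it is bounded.
\<close>

lemma pr_le_iff_class_count:
  assumes R: "equiv UNIV R" "primrec_rel R" and S: "equiv UNIV S" "primrec_rel S"
  shows "R \<le>\<^sub>p\<^sub>r S \<longleftrightarrow> (\<exists>h. primrec_fun h \<and> (\<forall>x. class_count R x \<le> class_count S (h x)))"
proof
  assume "R \<le>\<^sub>p\<^sub>r S"
  then obtain f where f: "primrec_fun f" "\<And>x y. (x, y) \<in> R \<longleftrightarrow> (f x, f y) \<in> S"
    unfolding pr_le_def by blast
  define h where "h x = (\<Sum>i<Suc x. f i)" for x
  have "primrec_fun h"
    unfolding primrec_fun_iff_pr h_def
    by (intro pr_intros pr_comp1[OF f(1)[unfolded primrec_fun_iff_pr]]) simp_all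
  moreover have "class_count R x \<le> class_count S (h x)" for x
    unfolding class_count_def
  proof (rule card_inj_on_le)
    let ?r = "\<lambda>y. LEAST z. (z, f y) \<in> S"
    show "inj_on ?r {y. y \<le> x \<and> minrep R y}"
      by (rule inj_onI) (use f(2) minrep_unique[OF R(1)] in \<open>auto simp: Least_rep_eq_iff[OF S(1)]\<close>)
    have "f y \<le> h x" if "y \<le> x" for y
      unfolding h_def using that by (intro member_le_sum) auto
    then show "?r ` {y. y \<le> x \<and> minrep R y} \<subseteq> {y. y \<le> h x \<and> minrep S y}"
      using minrep_Least(1,3)[OF S(1)] order_trans by blast
  qed simp
  ultimately show "\<exists>h. primrec_fun h \<and> (\<forall>x. class_count R x \<le> class_count S (h x))" by blast
next
  assume "\<exists>h. primrec_fun h \<and> (\<forall>x. class_count R x \<le> class_count S (h x))"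
  then obtain h where h: "primrec_fun h" "\<And>x. class_count R x \<le> class_count S (h x)" by blast
  have le: "class_index R x \<le> class_count S (h x)" for x
    using class_index_le_class_count[OF R(1)] h(2) order_trans by blast
  define g where "g x = (LEAST y. class_index R x \<le> class_count S y)" for x
  have g: "minrep S (g x)" "class_count S (g x) = class_index R x" for x
    unfolding g_def using minrep_Least_class_count[OF _ le] class_index_pos by auto
  have "pr 1 (\<lambda>xs. g (xs ! 0))"
    unfolding g_def
    by (rule pr_Least[where m = "\<lambda>xs. h (xs ! 0)"])
      (intro pr_intros pr_comp1[OF h(1)[unfolded primrec_fun_iff_pr]] R S le; simp)+
  moreover have "(x, y) \<in> R \<longleftrightarrow> (g x, g y) \<in> S" for x y
  proof
    assume "(x, y) \<in> R"
    then have "g x = g y" unfolding g_def by (simp add: class_index_eq_iff[OF R(1), symmetric])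
    then show "(g x, g y) \<in> S" using S(1) by (simp add: equiv_def refl_on_def)
  next
    assume "(g x, g y) \<in> S"
    then have "g x = g y" by (rule minrep_unique[OF S(1) g(1) g(1)])
    then have "class_index R x = class_index R y" using g(2) by metis
    then show "(x, y) \<in> R" by (simp add: class_index_eq_iff[OF R(1)])
  qed
  ultimately show "R \<le>\<^sub>p\<^sub>r S"
    unfolding pr_le_def primrec_fun_iff_pr by blast
qed

lemma class_count_unbounded:
  assumes "punctual R"
  shows "\<exists>x. b < class_count R x"
proof (rule ccontr)
  assume "\<not> ?thesis"
  then have "class_count R ` {y. minrep R y} \<subseteq> {..b}" by (auto simp: not_less)
  then have fin: "finite {y. minrep R y}"
    using inj_on_class_count_minrep finite_subset finite_imageD by blast
  have R: "equiv UNIV R" using assms by (simp add: punctual_def)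
  have "UNIV // R \<subseteq> (\<lambda>y. R `` {y}) ` {y. minrep R y}"
    using minrep_Least(1,2)[OF R] equiv_class_eq[OF R] by (auto simp: quotient_def) (metis image_eqI mem_Collect_eq)
  then have "finite (UNIV // R)"
    using fin by (rule finite_surj[rotated])
  then show False using assms by (simp add: punctual_def)
qed

text \<open>
  A nondecreasing function with increments at most one reaches a new value exactly where a new fibre
  begins; so it is, up to its initial value, the class count of the partition into its fibres.
\<close>

definition fibre_rel :: "(nat \<Rightarrow> nat) \<Rightarrow> nat rel" where
  "fibre_rel M = {(x, y). M x = M y}"

lemma equiv_fibre_rel: "equiv UNIV (fibre_rel M)"
  by (auto simp: fibre_rel_def equiv_def refl_on_def sym_def trans_def)

lemma class_count_fibre_rel:
  assumes "M 0 = 1" "mono M" "\<And>x. M (Suc x) \<le> Suc (M x)"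
  shows "class_count (fibre_rel M) x = M x"
proof (induction x)
  case (Suc x)
  have "minrep (fibre_rel M) (Suc x) \<longleftrightarrow> M (Suc x) \<noteq> M x"
  proof
    assume "M (Suc x) \<noteq> M x"
    then have "M x < M (Suc x)" using monoD[OF assms(2), of x "Suc x"] by simp
    moreover have "z < Suc x \<Longrightarrow> M z \<le> M x" for z using monoD[OF assms(2), of z x] by simp
    ultimately show "minrep (fibre_rel M) (Suc x)"
      by (fastforce simp: minrep_def fibre_rel_def)
  qed (auto simp: minrep_def fibre_rel_def)
  then show ?case
    using Suc assms(3)[of x] monoD[OF assms(2), of x "Suc x"] by (auto simp: class_count_Suc)
qed (simp add: class_count_0 assms)

lemma punctual_fibre_rel:
  assumes "primrec_fun M" "\<And>b. \<exists>x. b < M x"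
  shows "punctual (fibre_rel M)"
  unfolding punctual_def
proof (intro conjI equiv_fibre_rel notI)
  have "pr_pred 2 (\<lambda>xs. M (xs ! 0) = M (xs ! 1))"
    by (intro pr_intros pr_comp1[OF assms(1)[unfolded primrec_fun_iff_pr]]) simp_all
  then show "primrec_rel (fibre_rel M)"
    unfolding primrec_rel_def pr_def fibre_rel_def by (auto elim!: ex_forward)
  assume "finite (UNIV // fibre_rel M)"
  moreover have "range M \<subseteq> (\<lambda>c. M (SOME z. z \<in> c)) ` (UNIV // fibre_rel M)"
  proof clarify
    fix x
    have "M x = M (SOME z. z \<in> fibre_rel M `` {x})"
      using someI[of "\<lambda>z. z \<in> fibre_rel M `` {x}" x] by (simp add: fibre_rel_def)
    then show "M x \<in> (\<lambda>c. M (SOME z. z \<in> c)) ` (UNIV // fibre_rel M)"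
      by (rule image_eqI) (rule quotientI[OF UNIV_I])
  qed
  ultimately have "finite (range M)" using finite_subset by blast
  then obtain b where "\<forall>x. M x \<le> b" unfolding finite_nat_set_iff_bounded_le by blast
  then show False using assms(2)[of b] by (metis leD)
qed

section \<open>Splitting a slowly growing count\<close>

text \<open>
  \<open>N\<close> is the class count of a punctual equivalence relation, and the last assumption says that
  the identity relation, whose count is \<open>Suc\<close>, does not reduce to it.
\<close>

locale slow_counting =
  fixes N :: "nat \<Rightarrow> nat"
  assumes N_0: "N 0 = 1"
    and mono_N: "mono N"
    and N_Suc: "N (Suc x) \<le> Suc (N x)"
    and N_unbounded: "\<exists>x. b < N x"
    and primrec_N: "primrec_fun N"
    and N_slow: "primrec_fun h \<Longrightarrow> \<exists>x. N (h x) \<le> x"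
begin

text \<open>
  The condition of success for index \<open>e\<close> at stage \<open>s\<close>, when the growing function has value \<open>m\<close>.
  Its value at an earlier point \<open>x\<close> is at least \<open>m - (s - x)\<close>, as it grows by at most one per stage;
  so the condition implies that this value exceeds \<open>N y \<ge> N (fgh e x)\<close>, without any reference to
  the history of the construction. All searches are bounded by the stage.
\<close>

definition overtakes :: "nat \<Rightarrow> nat \<Rightarrow> nat \<Rightarrow> bool" where
  "overtakes e m s \<longleftrightarrow> (\<exists>x<Suc s. \<exists>y<Suc s. fgh e x \<le> y \<and> N y + s < m + x)"

text \<open>
  The stages with phase \<open>k\<close> serve the index \<open>e = k div 4\<close> on the side \<open>k div 2 mod 2\<close>, and only the
  function of that side departs from \<open>N\<close>; its value is the second component. In an even phase it
  grows at full speed until it has overtaken \<open>N \<circ> fgh e\<close> somewhere; in the following odd phase it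
  waits until \<open>N\<close> has caught up, after which the sides can be exchanged without a jump.
\<close>

primrec state :: "nat \<Rightarrow> nat \<times> nat" where
  "state 0 = (0, 1)"
| "state (Suc s) = (case state s of (k, m) \<Rightarrow>
     (if even k \<and> overtakes (k div 4) m s \<or> odd k \<and> m = N s then Suc k else k,
      if even k \<and> \<not> overtakes (k div 4) m s then Suc m else max m (N (Suc s))))"

abbreviation phase :: "nat \<Rightarrow> nat" where "phase s \<equiv> fst (state s)"
abbreviation level :: "nat \<Rightarrow> nat" where "level s \<equiv> snd (state s)"

definition growth :: "nat \<Rightarrow> nat \<Rightarrow> nat" where
  "growth i s = (if phase s div 2 mod 2 = i then level s else N s)"

lemma N_le_level: "N s \<le> level s"
proof (induction s)
  case (Suc s)
  then have "N (Suc s) \<le> Suc (level s)"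
    using N_Suc[of s] by simp
  then show ?case by (simp add: case_prod_unfold)
qed (simp add: N_0)

lemma N_le_growth: "N s \<le> growth i s"
  by (simp add: growth_def N_le_level)

lemma min_growth: "min (growth 0 s) (growth 1 s) = N s"
  by (auto simp: growth_def N_le_level min_def intro: antisym)

lemma growth_0: "growth i 0 = 1"
  by (simp add: growth_def N_0)

text \<open>
  The only danger is a change of sides, and it takes place only when both functions agree with \<open>N\<close>.
\<close>

lemma growth_Suc: "growth i s \<le> growth i (Suc s) \<and> growth i (Suc s) \<le> Suc (growth i s)"
proof -
  let ?k = "phase s" and ?m = "level s"
  have N: "N s \<le> N (Suc s)" "N (Suc s) \<le> Suc (N s)" "N s \<le> ?m"
    using monoD[OF mono_N, of s "Suc s"] N_Suc N_le_level by auto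
  consider "phase (Suc s) div 2 = ?k div 2" "level (Suc s) \<in> {Suc ?m, max ?m (N (Suc s))}"
    | "?m = N s" "level (Suc s) = N (Suc s)"
  proof (cases "odd ?k \<and> ?m = N s")
    case True
    then show ?thesis using N by (intro that(2)) (auto simp: case_prod_unfold)
  next
    case False
    then show ?thesis by (intro that(1)) (auto simp: case_prod_unfold)
  qed
  then show ?thesis
  proof cases
    case 1
    then show ?thesis using N unfolding growth_def by (auto simp del: state.simps)
  next
    case 2
    then show ?thesis using N unfolding growth_def by (simp del: state.simps)
  qed
qed

lemma mono_growth: "mono (growth i)"
  using growth_Suc by (simp add: mono_iff_le_Suc)

lemma growth_add: "growth i (s + d) \<le> growth i s + d"
proof (induction d)
  case (Suc d)
  then show ?case using growth_Suc[of i "s + d"] by simp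
qed simp

text \<open>
  The two components of the state are computed by a simultaneous recursion, hence the pairing.
\<close>

lemma primrec_growth: "primrec_fun (growth i)"
proof -
  let ?k = "\<lambda>c. fst (prod_decode c)" and ?m = "\<lambda>c. snd (prod_decode c)"
  note pr_N = pr_comp1[OF primrec_N[unfolded primrec_fun_iff_pr]]
  have over: "pr_pred n (\<lambda>xs. overtakes (f xs) (g xs) (h xs))" if "pr n f" "pr n g" "pr n h" for n f g h
    by (rule pr_comp3[OF _ that], unfold overtakes_def) (intro pr_intros pr_N; simp)
  have code: "rec_nat (prod_encode (0, 1)) (\<lambda>s c. prod_encode
       (if (?k c mod 2 = 0 \<and> overtakes (?k c div 4) (?m c) s) \<or> (\<not> ?k c mod 2 = 0 \<and> ?m c = N s)
         then Suc (?k c) else ?k c,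
        if ?k c mod 2 = 0 \<and> \<not> overtakes (?k c div 4) (?m c) s then Suc (?m c) else max (?m c) (N (Suc s)))) s
     = prod_encode (state s)" (is "rec_nat ?z ?st s = _") for s
    by (induction s) (auto simp: case_prod_unfold even_iff_mod_2_eq_zero)
  have "pr 1 (\<lambda>xs. rec_nat ?z ?st (xs ! 0))"
    by (intro pr_rec pr_intros pr_N over; simp)
  then have enc: "pr 1 (\<lambda>xs. prod_encode (state (xs ! 0)))"
    by (simp only: code)
  have "pr 1 (\<lambda>xs. if ?k (prod_encode (state (xs ! 0))) div 2 mod 2 = i
      then ?m (prod_encode (state (xs ! 0))) else N (xs ! 0))"
    by (intro pr_intros enc pr_N) simp
  then show ?thesis
    unfolding primrec_fun_iff_pr by (rule pr_cong) (simp add: growth_def)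
qed

text \<open>
  No phase lasts forever. In an endless even phase, started at \<open>s0\<close>, the function would grow at
  full speed without overtaking \<open>N \<circ> fgh e\<close>, which gives \<open>x \<le> N (fgh e x) + s0\<close> for all \<open>x\<close>;
  a shift of the argument by \<open>Suc s0\<close> then contradicts the slowness of \<open>N\<close>. An endless odd phase
  would bound \<open>N\<close>.
\<close>

lemma phase_leaves:
  assumes "phase s0 = k"
  shows "\<exists>s\<ge>s0. phase s = k \<and> phase (Suc s) = Suc k"
proof (rule ccontr)
  assume never: "\<not> ?thesis"
  have phase: "phase s = k" if "s0 \<le> s" for s
    using that
  proof (induction s rule: dec_induct)
    case (step s)
    then have "phase (Suc s) \<noteq> Suc k" using never by auto
    then show ?case using step by (simp add: case_prod_unfold split: if_splits)
  qed (rule assms)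
  then have stuck: "\<not> (even k \<and> overtakes (k div 4) (level s) s)" "\<not> (odd k \<and> level s = N s)" if "s0 \<le> s" for s
    using phase[OF that] phase[of "Suc s"] that by (auto simp: case_prod_unfold split: if_splits)
  show False
  proof (cases "even k")
    case True
    define e where "e = k div 4"
    have level: "level (s0 + d) = level s0 + d" for d
    proof (induction d)
      case (Suc d)
      then show ?case using stuck(1)[of "s0 + d"] phase[of "s0 + d"] True by (simp add: case_prod_unfold)
    qed simp
    have "x \<le> N (fgh e x) + s0" for x
    proof -
      \<comment> \<open>a stage late enough to admit \<open>x\<close> and \<open>fgh e x\<close> in the bounded search\<close>
      let ?s = "s0 + (x + fgh e x)"
      have "\<not> overtakes e (level s0 + (x + fgh e x)) ?s"
        using stuck(1)[of ?s] True unfolding level e_def by simp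
      then have "\<not> (x < Suc ?s \<and> fgh e x < Suc ?s \<and> fgh e x \<le> fgh e x
          \<and> N (fgh e x) + ?s < level s0 + (x + fgh e x) + x)"
        unfolding overtakes_def by blast
      then show ?thesis by simp
    qed
    moreover have "primrec_fun (\<lambda>x. fgh e (x + Suc s0))"
      unfolding primrec_fun_iff_pr by (intro pr_fgh_index pr_intros) simp
    then obtain x where "N (fgh e (x + Suc s0)) \<le> x" using N_slow by blast
    ultimately show False by (metis add_Suc_right add_le_mono1 not_less_eq_eq order_trans)
  next
    case False
    have level: "level (s0 + d) = level s0" for d
    proof (induction d)
      case (Suc d)
      have "N (s0 + d) < level (s0 + d)"
        using stuck(2)[of "s0 + d"] False N_le_level[of "s0 + d"] by simp
      then have "N (Suc (s0 + d)) \<le> level (s0 + d)"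
        using N_Suc[of "s0 + d"] by simp
      then show ?case using Suc False phase[of "s0 + d"] by (simp add: case_prod_unfold)
    qed simp
    obtain x where "level s0 < N x" using N_unbounded by blast
    also have "\<dots> \<le> N (s0 + x)" by (rule monoD[OF mono_N]) simp
    also have "\<dots> \<le> level s0" using N_le_level[of "s0 + x"] level by simp
    finally show False by simp
  qed
qed

lemma phase_reached: "\<exists>s. phase s = k"
proof (induction k)
  case (Suc k)
  then show ?case using phase_leaves by blast
qed (auto intro: exI[of _ 0])

text \<open>
  The phase \<open>4 * e + 2 * i\<close> is entered and left again, and it is left only on success.
\<close>

lemma growth_overtakes:
  assumes "i < 2"
  shows "\<exists>x. N (fgh e x) < growth i x"
proof -
  define k where "k = 4 * e + 2 * i"
  have k: "even k" "k div 4 = e" "k div 2 mod 2 = i"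
    using assms by (auto simp: k_def less_2_cases_iff)
  obtain s where s: "phase s = k" "phase (Suc s) = Suc k"
    using phase_reached phase_leaves by blast
  then have "overtakes e (level s) s"
    using k by (auto simp: case_prod_unfold split: if_splits)
  then obtain x y where xy: "x \<le> s" "fgh e x \<le> y" "N y + s < level s + x"
    unfolding overtakes_def by (auto simp: less_Suc_eq_le)
  have "level s = growth i s" using s k by (simp add: growth_def)
  also have "\<dots> \<le> growth i x + (s - x)"
    using growth_add[of i x "s - x"] xy by simp
  finally have "N y < growth i x" using xy by simp
  moreover have "N (fgh e x) \<le> N y" using xy mono_N by (simp add: monoD)
  ultimately show ?thesis by (intro exI[of _ x]) simp
qed

text \<open>
  It suffices to defeat the functions of the hierarchy, since they dominate all primitive recursive
  functions and \<open>N\<close> is monotone.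
\<close>

lemma growth_not_dominated:
  assumes "primrec_fun h" "i < 2"
  shows "\<exists>x. N (h x) < growth i x"
proof -
  obtain e where e: "\<And>x. h x \<le> fgh e x" using primrec_fun_fgh_bounded[OF assms(1)] by blast
  obtain x where "N (fgh e x) < growth i x" using growth_overtakes[OF assms(2)] by blast
  moreover have "N (h x) \<le> N (fgh e x)" using e mono_N by (simp add: monoD)
  ultimately show ?thesis by (intro exI[of _ x]) simp
qed

end

section \<open>Meet-reducibility below the top degree\<close>

lemma class_count_Id: "class_count Id x = Suc x"
proof -
  have "{y. y \<le> x \<and> minrep Id y} = {..x}" by (auto simp: minrep_def)
  then show ?thesis by (simp add: class_count_def)
qed

lemma primrec_rel_Id: "primrec_rel Id"
proof -
  have "pr_pred 2 (\<lambda>xs. xs ! 0 = xs ! 1)"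
    by (intro pr_intros) simp_all
  then show ?thesis
    unfolding primrec_rel_def pr_def by (auto elim!: ex_forward)
qed

text \<open>
  A relation below both \<open>S0\<close> and \<open>S1\<close> has a class count dominated by both functions \<open>growth 0\<close> and
  \<open>growth 1\<close>; with a common bound on the arguments it is dominated by their minimum, which is the
  class count of \<open>R\<close>.
\<close>

lemma not_top_splits:
  assumes R: "punctual R" and less: "R <\<^sub>p\<^sub>r Id"
  obtains S0 S1 where "punctual S0" "punctual S1" "R <\<^sub>p\<^sub>r S0" "R <\<^sub>p\<^sub>r S1"
    "\<And>T. punctual T \<Longrightarrow> T \<le>\<^sub>p\<^sub>r S0 \<Longrightarrow> T \<le>\<^sub>p\<^sub>r S1 \<Longrightarrow> T \<le>\<^sub>p\<^sub>r R"
proof -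
  have eqR: "equiv UNIV R" "primrec_rel R" using R by (simp_all add: punctual_def)
  have le_iff: "T \<le>\<^sub>p\<^sub>r S \<longleftrightarrow> (\<exists>h. primrec_fun h \<and> (\<forall>x. class_count T x \<le> class_count S (h x)))"
    if "punctual T" "punctual S" for T S
    using that by (intro pr_le_iff_class_count) (simp_all add: punctual_def)
  interpret slow_counting "class_count R"
  proof
    show "primrec_fun (class_count R)"
      unfolding primrec_fun_iff_pr by (intro pr_intros eqR) simp
    fix h assume h: "primrec_fun h"
    have "\<not> Id \<le>\<^sub>p\<^sub>r R" using less by (simp add: pr_less_def)
    then have "\<exists>x. \<not> class_count Id x \<le> class_count R (h x)"
      using h pr_le_iff_class_count[OF _ primrec_rel_Id eqR] by (auto simp: equiv_def refl_on_def sym_def trans_def)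
    then show "\<exists>x. class_count R (h x) \<le> x" by (auto simp: class_count_Id not_le less_Suc_eq_le)
  qed (auto simp: class_count_0 class_count_Suc mono_class_count class_count_unbounded[OF R])
  define S where "S i = fibre_rel (growth i)" for i
  have class_count_S: "class_count (S i) x = growth i x" for i x
    unfolding S_def using growth_Suc by (intro class_count_fibre_rel growth_0 mono_growth) simp
  have punctual_S: "punctual (S i)" for i
    unfolding S_def
  proof (rule punctual_fibre_rel[OF primrec_growth])
    fix b show "\<exists>x. b < growth i x" using N_unbounded N_le_growth less_le_trans by blast
  qed
  have "primrec_fun (\<lambda>x. x)" unfolding primrec_fun_iff_pr by (intro pr_intros) simp
  then have "R \<le>\<^sub>p\<^sub>r S i" for i
    unfolding le_iff[OF R punctual_S] class_count_S using N_le_growth by blast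
  moreover have "\<not> S i \<le>\<^sub>p\<^sub>r R" if "i < 2" for i
    unfolding le_iff[OF punctual_S R] class_count_S using growth_not_dominated[OF _ that] by (meson not_le)
  ultimately have less_S: "R <\<^sub>p\<^sub>r S i" if "i < 2" for i
    using that by (simp add: pr_less_def)
  have "T \<le>\<^sub>p\<^sub>r R" if T: "punctual T" "T \<le>\<^sub>p\<^sub>r S 0" "T \<le>\<^sub>p\<^sub>r S 1" for T
  proof -
    obtain h0 h1 where h: "primrec_fun h0" "primrec_fun h1"
      "\<And>x. class_count T x \<le> growth 0 (h0 x)" "\<And>x. class_count T x \<le> growth 1 (h1 x)"
      using T(2,3) unfolding le_iff[OF T(1) punctual_S] class_count_S by blast
    define h where "h x = max (h0 x) (h1 x)" for x
    have "primrec_fun h"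
      unfolding primrec_fun_iff_pr h_def using h(1,2)
      by (intro pr_intros) (simp_all add: primrec_fun_iff_pr)
    moreover have "class_count T x \<le> class_count R (h x)" for x
    proof -
      have "growth 0 (h0 x) \<le> growth 0 (h x)" "growth 1 (h1 x) \<le> growth 1 (h x)"
        unfolding h_def by (simp_all add: monoD[OF mono_growth])
      then have "class_count T x \<le> min (growth 0 (h x)) (growth 1 (h x))"
        using h(3,4)[of x] by simp
      then show ?thesis by (simp only: min_growth)
    qed
    ultimately show ?thesis using le_iff[OF T(1) R] by blast
  qed
  with that[of "S 0" "S 1"] punctual_S less_S show ?thesis by simp
qed

theorem theorem7p6:
  fixes Z :: "nat set"
  assumes "punctual (R_of Z)"
    and "R_of Z <\<^sub>p\<^sub>r Id"
  shows "meet_reducible Peq (pr_degree (R_of Z)) \<and>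
    (\<exists>S0 S1. punctual S0 \<and> punctual S1 \<and> R_of Z <\<^sub>p\<^sub>r S0 \<and> R_of Z <\<^sub>p\<^sub>r S1 \<and>
       is_glb Peq (pr_degree (R_of Z)) {pr_degree S0, pr_degree S1})"
proof -
  let ?R = "R_of Z"
  obtain S0 S1 where S: "punctual S0" "punctual S1" "?R <\<^sub>p\<^sub>r S0" "?R <\<^sub>p\<^sub>r S1"
    and meet: "\<And>T. punctual T \<Longrightarrow> T \<le>\<^sub>p\<^sub>r S0 \<Longrightarrow> T \<le>\<^sub>p\<^sub>r S1 \<Longrightarrow> T \<le>\<^sub>p\<^sub>r ?R"
    using not_top_splits[OF assms] by blast
  have lt: "pr_degree ?R \<sqsubset>\<^bsub>Peq\<^esub> pr_degree S" if "punctual S" "?R <\<^sub>p\<^sub>r S" for S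
    unfolding lless_def Peq_eq using that assms(1) Peq_le_iff[of _ S] Peq_le_iff[of S ?R]
    by (metis Peq_le_iff pr_le_refl pr_less_def)
  have "is_glb Peq (pr_degree ?R) {pr_degree S0, pr_degree S1}"
    unfolding greatest_def
  proof (intro conjI ballI subsetI)
    show "pr_degree ?R \<in> Lower Peq {pr_degree S0, pr_degree S1}"
      using S assms(1) by (auto simp: Lower_def Peq_carrier Peq_le_iff pr_less_def)
    fix d assume d: "d \<in> Lower Peq {pr_degree S0, pr_degree S1}"
    then have "d \<in> carrier Peq" by (simp add: Lower_def)
    then obtain T where T: "punctual T" "d = pr_degree T" by (rule Peq_carrierE)
    then show "d \<sqsubseteq>\<^bsub>Peq\<^esub> pr_degree ?R"
      using d S meet[of T] assms(1) by (auto simp: Lower_def Peq_carrier Peq_le_iff)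
  qed (auto simp: Lower_def Peq_carrier)
  then show ?thesis
    unfolding meet_reducible_def using S lt assms(1) by (auto simp: Peq_carrier)
qed

end
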